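(* Let $u\in\mathbb C^2$. For every integer $k\geq1$ there exists $v_k\in\mathbb C$ such that $m_{\mathfrak{sl},3}(v_k;u)=k$.
   Context: $\mathfrak g_{\mathfrak{sl}}=\mathfrak{sl}(3,\mathbb C)=\mathfrak n_-\oplus\mathfrak a_{\mathfrak{sl}}\oplus\mathfrak n_+$ with $\mathfrak a_{\mathfrak{sl}}$ the traceless diagonal matrices, $\mathfrak n_-$ (resp. $\mathfrak n_+$) strictly lower (resp. upper) triangular matrices, $\mathfrak b_{\mathfrak{sl}}=\mathfrak a_{\mathfrak{sl}}\oplus\mathfrak n_+$. For $u\in\mathbb C^2$, $\mathbb C_u$ is the character $z_1(E_{11}-E_{22})+z_2(E_{22}-E_{33})\mapsto u_1z_1+u_2z_2$ of $\mathfrak a_{\mathfrak{sl}}$, with Verma module $M^{\mathfrak g_{\mathfrak{sl}}}_{\mathfrak b_{\mathfrak{sl}}}(u)$. Let $\iota_3\begin{pmatrix}a&b\\c&d\end{pmatrix}=\begin{pmatrix}a&0&b\\0&0&0\\c&0&d\end{pmatrix}$, $\mathfrak g'_{\mathfrak{sl},3}=\iota_3(\mathfrak{sl}(2,\mathbb C))$, $\mathfrak a'_{\mathfrak{sl},3}=\mathbb C(E_{11}-E_{33})$, $\mathfrak n'_{3,-}=\mathbb CE_{31}$, $\mathfrak b'_{\mathfrak{sl},3}=\mathfrak b_{\mathfrak{sl}}\cap\mathfrak g'_{\mathfrak{sl},3}$. For $v\in\mathbb C$, $\mathbb C_v$ is the character $z(E_{11}-E_{33})\mapsto vz$ of $\mathfrak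 a'_{\mathfrak{sl},3}$. $m_{\mathfrak{sl},3}(v;u)=\dim_{\mathbb C}\mathrm{Hom}_{\mathfrak a'_{\mathfrak{sl},3}}(\mathbb C_v,\mathbb C_u|_{\mathfrak a'_{\mathfrak{sl},3}}\otimes S(\mathfrak n_-/\mathfrak n_{3,-}'))$, where $S(\cdot)$ is the symmetric algebra with the adjoint action; by Kobayashi's character identity this is the multiplicity of the Verma module $[M^{\mathfrak g'_{\mathfrak{sl},3}}_{\mathfrak b'_{\mathfrak{sl},3}}(v)]$ in the branching law of $[M^{\mathfrak g_{\mathfrak{sl}}}_{\mathfrak b_{\mathfrak{sl}}}(u)|_{\mathfrak g'_{\mathfrak{sl},3}}]$ in the Grothendieck group. *)

theory Defs
  imports
    "HOL-Analysis.Cartesian_Space"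
    "HOL-Library.Function_Algebras"
    "HOL-Library.Multiset"
    "HOL-Library.Poly_Mapping"
begin

section \<open>Complex vector spaces\<close>

class complex_vec = ab_group_add +
  fixes scaleC :: "complex \<Rightarrow> 'a \<Rightarrow> 'a" (infixr \<open>*\<^sub>C\<close> 75)
  assumes scaleC_add_right: "a *\<^sub>C (x + y) = a *\<^sub>C x + a *\<^sub>C y"
    and scaleC_add_left: "(a + b) *\<^sub>C x = a *\<^sub>C x + b *\<^sub>C x"
    and scaleC_scaleC: "a *\<^sub>C b *\<^sub>C x = (a * b) *\<^sub>C x"
    and scaleC_one: "1 *\<^sub>C x = x"

global_interpretation cvec: vector_space "scaleC :: complex \<Rightarrow> 'a \<Rightarrow> 'a::complex_vec"
  by unfold_locales (simp_all add: scaleC_add_right scaleC_add_left scaleC_scaleC scaleC_one)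

abbreviation clinear :: "('a::complex_vec \<Rightarrow> 'b::complex_vec) \<Rightarrow> bool"
  where "clinear \<equiv> Vector_Spaces.linear scaleC scaleC"

lemma clinear_iff:
  fixes f :: "'a::complex_vec \<Rightarrow> 'b::complex_vec"
  shows "clinear f \<longleftrightarrow> (\<forall>x y. f (x + y) = f x + f y) \<and> (\<forall>c x. f (c *\<^sub>C x) = c *\<^sub>C f x)"
  by (simp add: Vector_Spaces.linear_iff cvec.vector_space_axioms)

instantiation complex :: complex_vec
begin
definition scaleC_complex :: "complex \<Rightarrow> complex \<Rightarrow> complex" where
  "scaleC_complex c z = c * z"
instance by standard (simp_all add: scaleC_complex_def algebra_simps)
end

instantiation "fun" :: (type, complex_vec) complex_vec
begin
definition scaleC_fun :: "complex \<Rightarrow> ('a \<Rightarrow> 'b) \<Rightarrow> 'a \<Rightarrow> 'b" where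
  "scaleC_fun c f = (\<lambda>x. c *\<^sub>C f x)"
instance by standard
  (simp_all add: scaleC_fun_def fun_eq_iff scaleC_add_right scaleC_add_left scaleC_scaleC scaleC_one)
end

instantiation vec :: (complex_vec, finite) complex_vec
begin
definition scaleC_vec :: "complex \<Rightarrow> 'a ^ 'b \<Rightarrow> 'a ^ 'b" where
  "scaleC_vec c x = (\<chi> i. c *\<^sub>C (x $ i))"
instance by standard
  (simp_all add: scaleC_vec_def vec_eq_iff scaleC_add_right scaleC_add_left scaleC_scaleC scaleC_one)
end

lemma scaleC_vec_nth [simp]: "(c *\<^sub>C x) $ i = c *\<^sub>C (x $ i)"
  by (simp add: scaleC_vec_def)

instantiation poly_mapping :: (type, complex_vec) complex_vec
begin
lift_definition scaleC_poly_mapping :: "complex \<Rightarrow> ('a \<Rightarrow>\<^sub>0 'b) \<Rightarrow> 'a \<Rightarrow>\<^sub>0 'b"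
  is "\<lambda>c f x. c *\<^sub>C f x"
  by (erule rev_finite_subset) auto
instance by standard
  (transfer, simp add: fun_eq_iff scaleC_add_right scaleC_add_left scaleC_scaleC scaleC_one)+
end

lemma lookup_scaleC [simp]: "Poly_Mapping.lookup (c *\<^sub>C p) k = c *\<^sub>C Poly_Mapping.lookup p k"
  by (simp add: scaleC_poly_mapping.rep_eq)

lemma scaleC_single: "c *\<^sub>C Poly_Mapping.single k d = Poly_Mapping.single k (c *\<^sub>C d)"
  by (rule poly_mapping_eqI) (simp add: lookup_single when_def)

lemma scaleC_eq_single_mult:
  fixes p :: "'a::comm_monoid_add \<Rightarrow>\<^sub>0 complex"
  shows "c *\<^sub>C p = Poly_Mapping.single 0 c * p"
  by (rule poly_mapping_eqI)
    (simp add: scaleC_complex_def mult_map_scale_conv_mult[symmetric] Poly_Mapping.map.rep_eq when_def)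

lemma poly_mapping_add_induct [case_names zero single add]:
  fixes p :: "'a \<Rightarrow>\<^sub>0 'b::comm_monoid_add"
  assumes "P 0" "\<And>k c. P (Poly_Mapping.single k c)" "\<And>p q. P p \<Longrightarrow> P q \<Longrightarrow> P (p + q)"
  shows "P p"
proof -
  have "p = (\<Sum>k\<in>Poly_Mapping.keys p. Poly_Mapping.single k (Poly_Mapping.lookup p k))"
    by (rule poly_mapping_eqI)
      (auto simp: lookup_sum lookup_single when_def in_keys_iff)
  moreover have "P (\<Sum>k\<in>A. Poly_Mapping.single k (Poly_Mapping.lookup p k))" if "finite A" for A
    using that by induction (auto intro: assms)
  ultimately show ?thesis by (metis finite_keys)
qed

definition lin_ext :: "('a \<Rightarrow> 'b::complex_vec) \<Rightarrow> ('a \<Rightarrow>\<^sub>0 complex) \<Rightarrow> 'b" where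
  "lin_ext f p = (\<Sum>k\<in>Poly_Mapping.keys p. Poly_Mapping.lookup p k *\<^sub>C f k)"

lemma lin_ext_superset:
  assumes "finite A" "Poly_Mapping.keys p \<subseteq> A"
  shows "lin_ext f p = (\<Sum>k\<in>A. Poly_Mapping.lookup p k *\<^sub>C f k)"
  unfolding lin_ext_def using assms
  by (intro sum.mono_neutral_left) (auto simp: in_keys_iff)

lemma lin_ext_single [simp]: "lin_ext f (Poly_Mapping.single k c) = c *\<^sub>C f k"
  by (subst lin_ext_superset[of "{k}"]) auto

lemma lin_ext_add: "lin_ext f (p + q) = lin_ext f p + lin_ext f q"
proof -
  let ?A = "Poly_Mapping.keys p \<union> Poly_Mapping.keys q"
  have "Poly_Mapping.keys (p + q) \<subseteq> ?A" by (fact keys_add)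
  then show ?thesis
    by (subst (1 2 3) lin_ext_superset[of ?A])
      (auto simp: lookup_add scaleC_add_left sum.distrib)
qed

lemma lin_ext_scaleC: "lin_ext f (c *\<^sub>C p) = c *\<^sub>C lin_ext f p"
  by (subst lin_ext_superset[of "Poly_Mapping.keys p"])
    (auto simp: lin_ext_def in_keys_iff scaleC_complex_def cvec.scale_sum_right)

lemma clinear_lin_ext: "clinear (lin_ext f)"
  by (simp add: clinear_iff lin_ext_add lin_ext_scaleC)


section \<open>Tensor products\<close>

text \<open>The tensor product over the complex numbers: the free vector space on pairs
  modulo the bilinearity relations.\<close>

definition tensor_rels :: "('a::complex_vec \<times> 'b::complex_vec \<Rightarrow>\<^sub>0 complex) set" where
  "tensor_rels =
    {Poly_Mapping.single (x + x', y) 1 - Poly_Mapping.single (x, y) 1 - Poly_Mapping.single (x', y) 1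
      | x x' y. True} \<union>
    {Poly_Mapping.single (x, y + y') 1 - Poly_Mapping.single (x, y) 1 - Poly_Mapping.single (x, y') 1
      | x y y'. True} \<union>
    {Poly_Mapping.single (c *\<^sub>C x, y) 1 - c *\<^sub>C Poly_Mapping.single (x, y) 1 | c x y. True} \<union>
    {Poly_Mapping.single (x, c *\<^sub>C y) 1 - c *\<^sub>C Poly_Mapping.single (x, y) 1 | c x y. True}"

definition tensor_eq ::
  "('a::complex_vec \<times> 'b::complex_vec \<Rightarrow>\<^sub>0 complex) \<Rightarrow> ('a \<times> 'b \<Rightarrow>\<^sub>0 complex) \<Rightarrow> bool" where
  "tensor_eq p q \<longleftrightarrow> p - q \<in> cvec.span tensor_rels"

lemma equivp_diff_mem:
  fixes S :: "'a::ab_group_add set"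
  assumes "0 \<in> S" "\<And>x y. x \<in> S \<Longrightarrow> y \<in> S \<Longrightarrow> x + y \<in> S" "\<And>x. x \<in> S \<Longrightarrow> - x \<in> S"
  shows "equivp (\<lambda>p q. p - q \<in> S)"
proof (rule equivpI)
  show "reflp (\<lambda>p q. p - q \<in> S)" by (rule reflpI) (simp add: assms(1))
  show "symp (\<lambda>p q. p - q \<in> S)" by (rule sympI) (metis assms(3) minus_diff_eq)
  show "transp (\<lambda>p q. p - q \<in> S)"
  proof (rule transpI)
    fix x y z assume "x - y \<in> S" "y - z \<in> S"
    from assms(2)[OF this] show "x - z \<in> S" by simp
  qed
qed

quotient_type (overloaded) ('a, 'b) tensor =
  "('a::complex_vec \<times> 'b::complex_vec) \<Rightarrow>\<^sub>0 complex" / tensor_eq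
  unfolding tensor_eq_def
  by (rule equivp_diff_mem) (auto intro: cvec.span_zero cvec.span_add cvec.span_neg)

instantiation tensor :: (complex_vec, complex_vec) complex_vec
begin

lift_definition zero_tensor :: "('a, 'b) tensor" is 0 .

lift_definition plus_tensor :: "('a, 'b) tensor \<Rightarrow> ('a, 'b) tensor \<Rightarrow> ('a, 'b) tensor" is "(+)"
  unfolding tensor_eq_def by (metis add_diff_add cvec.span_add)

lift_definition uminus_tensor :: "('a, 'b) tensor \<Rightarrow> ('a, 'b) tensor" is uminus
  unfolding tensor_eq_def by (metis cvec.span_neg minus_diff_minus)

lift_definition minus_tensor :: "('a, 'b) tensor \<Rightarrow> ('a, 'b) tensor \<Rightarrow> ('a, 'b) tensor" is "(-)"
proof -
  fix p p' q q' :: "'a \<times> 'b \<Rightarrow>\<^sub>0 complex"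
  assume "tensor_eq p p'" "tensor_eq q q'"
  then have "(p - p') - (q - q') \<in> cvec.span tensor_rels"
    unfolding tensor_eq_def by (rule cvec.span_diff)
  then show "tensor_eq (p - q) (p' - q')"
    unfolding tensor_eq_def by (simp add: algebra_simps)
qed

lift_definition scaleC_tensor :: "complex \<Rightarrow> ('a, 'b) tensor \<Rightarrow> ('a, 'b) tensor" is scaleC
  unfolding tensor_eq_def by (metis cvec.span_scale cvec.scale_right_diff_distrib)

instance
  by standard
    (transfer,
      simp add: tensor_eq_def cvec.span_zero scaleC_add_right scaleC_add_left scaleC_scaleC scaleC_one)+

end

lift_definition tensor :: "'a::complex_vec \<Rightarrow> 'b::complex_vec \<Rightarrow> ('a, 'b) tensor" (infixr \<open>\<otimes>\<^sub>C\<close> 70)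
  is "\<lambda>x y. Poly_Mapping.single (x, y) 1" .

lemma tensor_bilinear:
  "(x + x') \<otimes>\<^sub>C y = x \<otimes>\<^sub>C y + x' \<otimes>\<^sub>C y"
  "x \<otimes>\<^sub>C (y + y') = x \<otimes>\<^sub>C y + x \<otimes>\<^sub>C y'"
  "(c *\<^sub>C x) \<otimes>\<^sub>C y = c *\<^sub>C (x \<otimes>\<^sub>C y)"
  "x \<otimes>\<^sub>C (c *\<^sub>C y) = c *\<^sub>C (x \<otimes>\<^sub>C y)"
  by (transfer, unfold tensor_eq_def diff_diff_add[symmetric], rule cvec.span_base,
      unfold tensor_rels_def, blast)+

lemma abs_tensor_cases:
  obtains p where "t = abs_tensor p"
  by (metis Quotient3_abs_rep Quotient3_tensor)

lemma tensor_induct [case_names zero tensor add]: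
  fixes t :: "('a::complex_vec, 'b::complex_vec) tensor"
  assumes "P 0" "\<And>x y. P (x \<otimes>\<^sub>C y)" "\<And>s t. P s \<Longrightarrow> P t \<Longrightarrow> P (s + t)"
  shows "P t"
proof (cases t rule: abs_tensor_cases)
  case (1 p)
  have "P (abs_tensor p)"
  proof (induction p rule: poly_mapping_add_induct)
    case zero
    then show ?case using assms(1) by (simp add: zero_tensor.abs_eq)
  next
    case (single k c)
    obtain x y where k: "k = (x, y)" by fastforce
    have "abs_tensor (Poly_Mapping.single k c) = (c *\<^sub>C x) \<otimes>\<^sub>C y"
      unfolding tensor_bilinear k
      by (simp add: tensor.abs_eq scaleC_tensor.abs_eq scaleC_single scaleC_complex_def)
    then show ?case using assms(2) by simp
  next
    case (add p q)
    then show ?case using assms(3) by (metis plus_tensor.abs_eq)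
  qed
  then show ?thesis using 1 by simp
qed

lemma tensor_lift:
  fixes h :: "'a::complex_vec \<Rightarrow> 'b::complex_vec \<Rightarrow> 'c::complex_vec"
  assumes "\<And>y. clinear (\<lambda>x. h x y)" "\<And>x. clinear (h x)"
  shows "\<exists>!T. clinear T \<and> (\<forall>x y. T (x \<otimes>\<^sub>C y) = h x y)"
proof (rule ex_ex1I)
  let ?F = "lin_ext (\<lambda>(x, y). h x y)"
  have F_diff: "?F (p - q) = ?F p - ?F q" for p q
    using clinear_lin_ext by (rule module_hom.diff[OF Vector_Spaces.linear.axioms(3)])
  have "tensor_rels \<subseteq> {p. ?F p = 0}"
    using assms
    by (auto simp: tensor_rels_def F_diff lin_ext_scaleC clinear_iff scaleC_one)
  moreover have "cvec.subspace {p. ?F p = 0}"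
    by (auto simp: cvec.subspace_def lin_ext_add lin_ext_scaleC) (simp add: lin_ext_def)
  ultimately have kernel: "cvec.span tensor_rels \<subseteq> {p. ?F p = 0}"
    by (rule cvec.span_minimal)
  define T where "T t = ?F (rep_tensor t)" for t
  have T_abs: "T (abs_tensor p) = ?F p" for p
  proof -
    have "tensor_eq (rep_tensor (abs_tensor p)) p"
      by (simp add: tensor.abs_eq_iff[symmetric] Quotient3_abs_rep[OF Quotient3_tensor])
    then have "?F (rep_tensor (abs_tensor p) - p) = 0"
      using kernel unfolding tensor_eq_def by blast
    then show ?thesis by (simp add: T_def F_diff)
  qed
  have "T (s + t) = T s + T t" for s t
    by (cases s rule: abs_tensor_cases; cases t rule: abs_tensor_cases) (simp add: plus_tensor.abs_eq T_abs lin_ext_add)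
  moreover have "T (c *\<^sub>C t) = c *\<^sub>C T t" for c t
    by (cases t rule: abs_tensor_cases) (simp add: scaleC_tensor.abs_eq T_abs lin_ext_scaleC)
  moreover have "T (x \<otimes>\<^sub>C y) = h x y" for x y
    by (simp add: tensor.abs_eq T_abs scaleC_one)
  ultimately show "\<exists>T. clinear T \<and> (\<forall>x y. T (x \<otimes>\<^sub>C y) = h x y)"
    by (auto simp: clinear_iff)
next
  fix T T' :: "('a, 'b) tensor \<Rightarrow> 'c"
  assume T: "clinear T \<and> (\<forall>x y. T (x \<otimes>\<^sub>C y) = h x y)"
    and T': "clinear T' \<and> (\<forall>x y. T' (x \<otimes>\<^sub>C y) = h x y)"
  have "T 0 = 0" "T' 0 = 0"
    using T T' by (metis clinear_iff cvec.scale_zero_left)+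
  then have "T t = T' t" for t
    using T T' by (induction t rule: tensor_induct) (simp_all add: clinear_iff)
  then show "T = T'" by blast
qed

text \<open>If \<open>f\<close> and \<open>g\<close> are the actions of a Lie algebra element on two representations,
  this is its action on their tensor product.\<close>

definition tensor_act ::
  "('a::complex_vec \<Rightarrow> 'a) \<Rightarrow> ('b::complex_vec \<Rightarrow> 'b) \<Rightarrow> ('a, 'b) tensor \<Rightarrow> ('a, 'b) tensor" where
  "tensor_act f g = (THE T. clinear T \<and> (\<forall>x y. T (x \<otimes>\<^sub>C y) = f x \<otimes>\<^sub>C y + x \<otimes>\<^sub>C g y))"

lemma tensor_act:
  fixes f :: "'a::complex_vec \<Rightarrow> 'a" and g :: "'b::complex_vec \<Rightarrow> 'b"
  assumes "clinear f" "clinear g"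
  shows "clinear (tensor_act f g)"
    and "tensor_act f g (x \<otimes>\<^sub>C y) = f x \<otimes>\<^sub>C y + x \<otimes>\<^sub>C g y"
proof -
  have "\<exists>!T. clinear T \<and> (\<forall>x y. T (x \<otimes>\<^sub>C y) = f x \<otimes>\<^sub>C y + x \<otimes>\<^sub>C g y)"
    using assms
    by (intro tensor_lift)
      (simp_all add: clinear_iff tensor_bilinear scaleC_add_right algebra_simps)
  from theI'[OF this] show "clinear (tensor_act f g)"
    and "tensor_act f g (x \<otimes>\<^sub>C y) = f x \<otimes>\<^sub>C y + x \<otimes>\<^sub>C g y"
    unfolding tensor_act_def by blast+
qed


section \<open>Symmetric algebras\<close>

text \<open>The symmetric algebra of \<open>V\<close>: the polynomial ring with one variable for each vector of \<open>V\<close>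
  (monomials are multisets of vectors), modulo the ideal generated by the linear relations
  between the vectors.\<close>

definition sym_rels :: "('v::complex_vec multiset \<Rightarrow>\<^sub>0 complex) set" where
  "sym_rels =
    {Poly_Mapping.single {#v + w#} 1 - Poly_Mapping.single {#v#} 1 - Poly_Mapping.single {#w#} 1
      | v w. True} \<union>
    {Poly_Mapping.single {#c *\<^sub>C v#} 1 - c *\<^sub>C Poly_Mapping.single {#v#} 1 | c v. True}"

text \<open>The span of a subset of a commutative ring, as a module over itself, is the ideal it
  generates. (There is deliberately no interpretation of the module locale here: its simplification
  rules loop with associativity of multiplication.)\<close>

definition ideal_gen :: "'a::comm_ring_1 set \<Rightarrow> 'a set" where
  "ideal_gen = module.span (*)"

lemma ring_module: "module ((*) :: 'a::comm_ring_1 \<Rightarrow> 'a \<Rightarrow> 'a)"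
  by unfold_locales (simp_all add: algebra_simps)

lemmas ideal_gen_zero = module.span_zero[OF ring_module, folded ideal_gen_def]
lemmas ideal_gen_base = module.span_base[OF ring_module, folded ideal_gen_def]
lemmas ideal_gen_add = module.span_add[OF ring_module, folded ideal_gen_def]
lemmas ideal_gen_diff = module.span_diff[OF ring_module, folded ideal_gen_def]
lemmas ideal_gen_neg = module.span_neg[OF ring_module, folded ideal_gen_def]
lemmas ideal_gen_mult = module.span_scale[OF ring_module, folded ideal_gen_def]
lemmas ideal_gen_induct = module.span_induct_alt[OF ring_module, folded ideal_gen_def,
    consumes 1, case_names base step]

definition sym_eq ::
  "('v::complex_vec multiset \<Rightarrow>\<^sub>0 complex) \<Rightarrow> ('v multiset \<Rightarrow>\<^sub>0 complex) \<Rightarrow> bool" where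
  "sym_eq p q \<longleftrightarrow> p - q \<in> ideal_gen sym_rels"

quotient_type (overloaded) 'v sym_alg = "'v::complex_vec multiset \<Rightarrow>\<^sub>0 complex" / sym_eq
  unfolding sym_eq_def
  by (rule equivp_diff_mem) (auto intro: ideal_gen_zero ideal_gen_add ideal_gen_neg)

lemma sym_rels_span_constant:
  fixes p :: "'a::complex_vec multiset \<Rightarrow>\<^sub>0 complex"
  assumes "p \<in> ideal_gen sym_rels"
  shows "Poly_Mapping.lookup p {#} = 0"
proof -
  have mult: "Poly_Mapping.lookup (p * q) {#} = Poly_Mapping.lookup p {#} * Poly_Mapping.lookup q {#}"
    for p q :: "'a multiset \<Rightarrow>\<^sub>0 complex"
  proof (induction p rule: poly_mapping_add_induct)
    case (single m c)
    show ?case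
      by (induction q rule: poly_mapping_add_induct)
        (auto simp: mult_single lookup_single when_def lookup_add algebra_simps)
  qed (simp_all add: lookup_add algebra_simps)
  have "Poly_Mapping.lookup r {#} = 0" if "r \<in> sym_rels" for r :: "'a multiset \<Rightarrow>\<^sub>0 complex"
    using that by (auto simp: sym_rels_def lookup_minus lookup_single when_def scaleC_complex_def)
  with assms show ?thesis
    by (induction rule: ideal_gen_induct) (simp_all add: lookup_add mult)
qed

lemma abs_sym_alg_cases:
  obtains p where "x = abs_sym_alg p"
  by (metis Quotient3_abs_rep Quotient3_sym_alg)

instantiation sym_alg :: (complex_vec) "{comm_ring_1, complex_vec}"
begin

lift_definition zero_sym_alg :: "'a sym_alg" is 0 .

lift_definition one_sym_alg :: "'a sym_alg" is 1 .

lift_definition plus_sym_alg :: "'a sym_alg \<Rightarrow> 'a sym_alg \<Rightarrow> 'a sym_alg" is "(+)"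
  unfolding sym_eq_def by (metis add_diff_add ideal_gen_add)

lift_definition uminus_sym_alg :: "'a sym_alg \<Rightarrow> 'a sym_alg" is uminus
  unfolding sym_eq_def by (metis ideal_gen_neg minus_diff_minus)

lift_definition minus_sym_alg :: "'a sym_alg \<Rightarrow> 'a sym_alg \<Rightarrow> 'a sym_alg" is "(-)"
proof -
  fix p p' q q' :: "'a multiset \<Rightarrow>\<^sub>0 complex"
  assume "sym_eq p p'" "sym_eq q q'"
  then have "(p - p') - (q - q') \<in> ideal_gen sym_rels"
    unfolding sym_eq_def by (rule ideal_gen_diff)
  then show "sym_eq (p - q) (p' - q')"
    unfolding sym_eq_def by (simp add: algebra_simps)
qed

lift_definition times_sym_alg :: "'a sym_alg \<Rightarrow> 'a sym_alg \<Rightarrow> 'a sym_alg" is "(*)"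
proof -
  fix p p' q q' :: "'a multiset \<Rightarrow>\<^sub>0 complex"
  assume "sym_eq p p'" "sym_eq q q'"
  then have "q * (p - p') + p' * (q - q') \<in> ideal_gen sym_rels"
    unfolding sym_eq_def by (intro ideal_gen_add ideal_gen_mult)
  then show "sym_eq (p * q) (p' * q')"
    unfolding sym_eq_def by (simp add: algebra_simps)
qed

lift_definition scaleC_sym_alg :: "complex \<Rightarrow> 'a sym_alg \<Rightarrow> 'a sym_alg" is scaleC
  unfolding sym_eq_def scaleC_eq_single_mult right_diff_distrib[symmetric]
  by (rule ideal_gen_mult)

instance
proof
  fix p q r :: "'a sym_alg" and a b :: complex
  obtain p' where p: "p = abs_sym_alg p'" by (rule abs_sym_alg_cases)
  obtain q' where q: "q = abs_sym_alg q'" by (rule abs_sym_alg_cases)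
  obtain r' where r: "r = abs_sym_alg r'" by (rule abs_sym_alg_cases)
  note ops = p q r zero_sym_alg.abs_eq one_sym_alg.abs_eq plus_sym_alg.abs_eq uminus_sym_alg.abs_eq
    minus_sym_alg.abs_eq times_sym_alg.abs_eq scaleC_sym_alg.abs_eq
  show "p + q + r = p + (q + r)" by (simp only: ops add.assoc)
  show "p + q = q + p" unfolding ops by (simp only: add.commute)
  show "0 + p = p" by (simp only: ops add_0_left)
  show "- p + p = 0" by (simp only: ops left_minus)
  show "p - q = p + - q" by (simp only: ops diff_conv_add_uminus)
  show "p * q * r = p * (q * r)" by (simp only: ops mult.assoc)
  show "p * q = q * p" unfolding ops by (simp only: mult.commute)
  show "1 * p = p" by (simp only: ops mult_1_left)
  show "(p + q) * r = p * r + q * r" by (simp only: ops distrib_right)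
  show "(0 :: 'a sym_alg) \<noteq> 1"
    using sym_rels_span_constant[of "0 - 1 :: 'a multiset \<Rightarrow>\<^sub>0 complex"]
    by (auto simp: zero_sym_alg.abs_eq one_sym_alg.abs_eq sym_alg.abs_eq_iff sym_eq_def
        lookup_minus lookup_one)
  show "a *\<^sub>C (p + q) = a *\<^sub>C p + a *\<^sub>C q" by (simp only: ops scaleC_add_right)
  show "(a + b) *\<^sub>C p = a *\<^sub>C p + b *\<^sub>C p" by (simp only: ops scaleC_add_left)
  show "a *\<^sub>C b *\<^sub>C p = (a * b) *\<^sub>C p" by (simp only: ops scaleC_scaleC)
  show "1 *\<^sub>C p = p" by (simp only: ops scaleC_one)
qed

end

lift_definition sym_gen :: "'v::complex_vec \<Rightarrow> 'v sym_alg"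
  is "\<lambda>v. Poly_Mapping.single {#v#} 1" .

text \<open>The action of a linear endomorphism of \<open>V\<close> on the symmetric algebra, by derivations.\<close>

definition sym_act :: "('v::complex_vec \<Rightarrow> 'v) \<Rightarrow> 'v sym_alg \<Rightarrow> 'v sym_alg" where
  "sym_act L = (THE D. clinear D \<and> (\<forall>x y. D (x * y) = D x * y + x * D y) \<and>
    (\<forall>v. D (sym_gen v) = sym_gen (L v)))"

lemma sym_gen_linear:
  "sym_gen (v + w) = sym_gen v + sym_gen w"
  "sym_gen (c *\<^sub>C v) = c *\<^sub>C sym_gen v"
  by (transfer, unfold sym_eq_def diff_diff_add[symmetric], rule ideal_gen_base,
      unfold sym_rels_def, blast)+

lemma sym_scaleC_mult:
  fixes x y :: "'v::complex_vec sym_alg"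
  shows "(c *\<^sub>C x) * y = c *\<^sub>C (x * y)" "x * (c *\<^sub>C y) = c *\<^sub>C (x * y)"
  by (cases x rule: abs_sym_alg_cases; cases y rule: abs_sym_alg_cases;
      simp add: scaleC_sym_alg.abs_eq times_sym_alg.abs_eq scaleC_eq_single_mult mult_ac)+

lemma sym_alg_induct [case_names one gen_mult add scaleC]:
  fixes x :: "'v::complex_vec sym_alg"
  assumes one: "P 1" and gen: "\<And>v x. P x \<Longrightarrow> P (sym_gen v * x)"
    and add: "\<And>x y. P x \<Longrightarrow> P y \<Longrightarrow> P (x + y)" and scaleC: "\<And>c x. P x \<Longrightarrow> P (c *\<^sub>C x)"
  shows "P x"
proof (cases x rule: abs_sym_alg_cases)
  case (1 p)
  have mono: "P (abs_sym_alg (Poly_Mapping.single m 1))" for m :: "'v multiset"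
  proof (induction m)
    case empty
    then show ?case using one by (simp add: one_sym_alg.abs_eq)
  next
    case (add v m)
    have "Poly_Mapping.single (add_mset v m) (1::complex)
        = Poly_Mapping.single {#v#} 1 * Poly_Mapping.single m 1"
      by (simp add: mult_single)
    then show ?case
      using gen[OF add.IH] by (metis times_sym_alg.abs_eq sym_gen.abs_eq)
  qed
  have "P (abs_sym_alg p)"
  proof (induction p rule: poly_mapping_add_induct)
    case zero
    have "0 = abs_sym_alg (0 *\<^sub>C Poly_Mapping.single {#} 1 :: 'v multiset \<Rightarrow>\<^sub>0 complex)"
      by (simp add: zero_sym_alg.abs_eq)
    then show ?case using scaleC[OF mono] by (metis scaleC_sym_alg.abs_eq zero_sym_alg.abs_eq)
  next
    case (single m c)
    have "Poly_Mapping.single m c = c *\<^sub>C Poly_Mapping.single m 1"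
      by (simp add: scaleC_single scaleC_complex_def)
    then show ?case using scaleC[OF mono] by (metis scaleC_sym_alg.abs_eq)
  next
    case (add p q)
    then show ?case using assms(3) by (metis plus_sym_alg.abs_eq)
  qed
  then show ?thesis using 1 by simp
qed

lemma sym_derivation_ex1:
  fixes L :: "'v::complex_vec \<Rightarrow> 'v"
  assumes L: "clinear L"
  shows "\<exists>!D. clinear D \<and> (\<forall>x y. D (x * y) = D x * y + x * D y) \<and>
    (\<forall>v. D (sym_gen v) = sym_gen (L v))"
proof (rule ex_ex1I)
  define d :: "'v multiset \<Rightarrow> 'v multiset \<Rightarrow>\<^sub>0 complex" where
    "d m = (\<Sum>v\<in>#m. Poly_Mapping.single (m - {#v#} + {#L v#}) 1)" for m
  let ?F = "lin_ext d"
  have d_add: "d (m + n) = d m * Poly_Mapping.single n 1 + Poly_Mapping.single m 1 * d n" for m n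
  proof -
    have 1: "(\<Sum>v\<in>#m. Poly_Mapping.single (m + n - {#v#} + {#L v#}) (1::complex))
        = d m * Poly_Mapping.single n 1"
      unfolding d_def sum_mset_distrib_right
      by (intro arg_cong[of _ _ sum_mset] image_mset_cong) (simp add: mult_single)
    have 2: "(\<Sum>v\<in>#n. Poly_Mapping.single (m + n - {#v#} + {#L v#}) (1::complex))
        = Poly_Mapping.single m 1 * d n"
      unfolding d_def sum_mset_distrib_left
      by (intro arg_cong[of _ _ sum_mset] image_mset_cong) (simp add: mult_single)
    show ?thesis unfolding 1[symmetric] 2[symmetric] by (simp add: d_def)
  qed
  have F_diff: "?F (p - q) = ?F p - ?F q" for p q
    using clinear_lin_ext by (rule module_hom.diff[OF Vector_Spaces.linear.axioms(3)])
  have F_0: "?F 0 = 0" by (simp add: lin_ext_def)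
  have single_eq: "Poly_Mapping.single m c = c *\<^sub>C Poly_Mapping.single m (1::complex)"
    for m :: "'v multiset" and c
    by (simp add: scaleC_single scaleC_complex_def)
  have smult: "(c *\<^sub>C p) * q = c *\<^sub>C (p * q)" "p * (c *\<^sub>C q) = c *\<^sub>C (p * q)"
    for p q :: "'v multiset \<Rightarrow>\<^sub>0 complex" and c
    by (simp_all add: scaleC_eq_single_mult mult_ac)
  have F_mult_mono: "?F (Poly_Mapping.single m c * q)
      = ?F (Poly_Mapping.single m c) * q + Poly_Mapping.single m c * ?F q" for m c q
  proof (induction q rule: poly_mapping_add_induct)
    case zero
    then show ?case by (simp add: F_0)
  next
    case (single n e)
    have "?F (Poly_Mapping.single m c * Poly_Mapping.single n e) = (c * e) *\<^sub>C d (m + n)"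
      by (simp add: mult_single)
    moreover have "?F (Poly_Mapping.single m c) * Poly_Mapping.single n e
        = (c * e) *\<^sub>C (d m * Poly_Mapping.single n 1)"
      by (subst (2) single_eq) (simp add: smult scaleC_scaleC mult.commute)
    moreover have "Poly_Mapping.single m c * ?F (Poly_Mapping.single n e)
        = (c * e) *\<^sub>C (Poly_Mapping.single m 1 * d n)"
      by (subst (1) single_eq) (simp add: smult scaleC_scaleC mult.commute)
    ultimately show ?case by (simp add: d_add scaleC_add_right)
  next
    case (add p q)
    then show ?case by (simp add: lin_ext_add distrib_left)
  qed
  have F_mult: "?F (p * q) = ?F p * q + p * ?F q" for p q
  proof (induction p rule: poly_mapping_add_induct)
    case zero
    then show ?case by (simp add: F_0)
  next
    case (single m c)
    then show ?case by (rule F_mult_mono)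
  next
    case (add p p')
    then show ?case by (simp add: lin_ext_add distrib_right)
  qed
  have F_gen: "?F (Poly_Mapping.single {#v#} 1) = Poly_Mapping.single {#L v#} 1" for v
    by (simp add: d_def scaleC_one)
  have F_rels: "?F r \<in> sym_rels" if r: "r \<in> sym_rels" for r
  proof -
    consider v w where "r = Poly_Mapping.single {#v + w#} 1 - Poly_Mapping.single {#v#} 1
        - Poly_Mapping.single {#w#} 1"
      | c v where "r = Poly_Mapping.single {#c *\<^sub>C v#} 1 - c *\<^sub>C Poly_Mapping.single {#v#} 1"
      using r unfolding sym_rels_def by blast
    then show ?thesis
    proof cases
      case 1
      then have "?F r = Poly_Mapping.single {#L v + L w#} 1 - Poly_Mapping.single {#L v#} 1
          - Poly_Mapping.single {#L w#} 1"
        unfolding 1 F_diff F_gen using L by (simp add: clinear_iff)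
      then show ?thesis unfolding sym_rels_def by blast
    next
      case 2
      then have "?F r = Poly_Mapping.single {#c *\<^sub>C L v#} 1
          - c *\<^sub>C Poly_Mapping.single {#L v#} 1"
        unfolding 2 F_diff lin_ext_scaleC F_gen using L by (simp add: clinear_iff)
      then show ?thesis unfolding sym_rels_def by blast
    qed
  qed
  have F_ideal: "?F p \<in> ideal_gen sym_rels" if "p \<in> ideal_gen sym_rels" for p
    using that
  proof (induction rule: ideal_gen_induct)
    case base
    then show ?case by (simp add: F_0 ideal_gen_zero)
  next
    case (step c x y)
    then show ?case
      by (simp add: lin_ext_add F_mult ideal_gen_add ideal_gen_mult ideal_gen_base F_rels)
  qed
  define D where "D x = abs_sym_alg (?F (rep_sym_alg x))" for x
  have D_abs: "D (abs_sym_alg p) = abs_sym_alg (?F p)" for p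
  proof -
    have "sym_eq (rep_sym_alg (abs_sym_alg p)) p"
      by (simp add: sym_alg.abs_eq_iff[symmetric] Quotient3_abs_rep[OF Quotient3_sym_alg])
    then have "?F (rep_sym_alg (abs_sym_alg p) - p) \<in> ideal_gen sym_rels"
      unfolding sym_eq_def by (rule F_ideal)
    then show ?thesis by (simp add: D_def F_diff sym_alg.abs_eq_iff sym_eq_def)
  qed
  have "D (x + y) = D x + D y" for x y
    by (cases x rule: abs_sym_alg_cases; cases y rule: abs_sym_alg_cases)
      (simp add: plus_sym_alg.abs_eq D_abs lin_ext_add)
  moreover have "D (c *\<^sub>C x) = c *\<^sub>C D x" for c x
    by (cases x rule: abs_sym_alg_cases) (simp add: scaleC_sym_alg.abs_eq D_abs lin_ext_scaleC)
  moreover have "D (x * y) = D x * y + x * D y" for x y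
    by (cases x rule: abs_sym_alg_cases; cases y rule: abs_sym_alg_cases)
      (simp add: plus_sym_alg.abs_eq times_sym_alg.abs_eq D_abs F_mult)
  moreover have "D (sym_gen v) = sym_gen (L v)" for v
    by (simp only: sym_gen.abs_eq D_abs F_gen)
  ultimately show "\<exists>D. clinear D \<and> (\<forall>x y. D (x * y) = D x * y + x * D y) \<and>
    (\<forall>v. D (sym_gen v) = sym_gen (L v))"
    by (auto simp: clinear_iff intro!: exI[of _ D])
next
  fix D D' :: "'v sym_alg \<Rightarrow> 'v sym_alg"
  assume D: "clinear D \<and> (\<forall>x y. D (x * y) = D x * y + x * D y) \<and> (\<forall>v. D (sym_gen v) = sym_gen (L v))"
    and D': "clinear D' \<and> (\<forall>x y. D' (x * y) = D' x * y + x * D' y) \<and> (\<forall>v. D' (sym_gen v) = sym_gen (L v))"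
  have "D (1 * 1) = D 1 * 1 + 1 * D 1" "D' (1 * 1) = D' 1 * 1 + 1 * D' 1"
    using D D' by blast+
  then have "D 1 = 0" "D' 1 = 0" by simp_all
  then have "D x = D' x" for x
    using D D' by (induction x rule: sym_alg_induct) (simp_all add: clinear_iff)
  then show "D = D'" by blast
qed

lemma sym_act:
  assumes "clinear L"
  shows "clinear (sym_act L)"
    and "sym_act L (x * y) = sym_act L x * y + x * sym_act L y"
    and "sym_act L (sym_gen v) = sym_gen (L v)"
  using theI'[OF sym_derivation_ex1[OF assms]] unfolding sym_act_def by blast+


section \<open>Representations\<close>

text \<open>The space of linear maps intertwining the actions \<open>\<rho>\<close> and \<open>\<sigma>\<close> of \<open>\<gg>\<close>.\<close>

definition rep_hom :: "'g set \<Rightarrow> ('g \<Rightarrow> 'a::complex_vec \<Rightarrow> 'a) \<Rightarrow> ('g \<Rightarrow> 'b::complex_vec \<Rightarrow> 'b) \<Rightarrow> ('a \<Rightarrow> 'b) set"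
  where "rep_hom \<gg> \<rho> \<sigma> = {f. clinear f \<and> (\<forall>X\<in>\<gg>. \<forall>x. f (\<rho> X x) = \<sigma> X (f x))}"

definition char_rep :: "('g \<Rightarrow> complex) \<Rightarrow> 'g \<Rightarrow> complex \<Rightarrow> complex" where
  "char_rep \<phi> X z = \<phi> X * z"

lemma clinear_char_rep: "clinear (char_rep \<phi> X)"
  by (simp add: clinear_iff char_rep_def scaleC_complex_def algebra_simps)

lemma rep_hom_subspace:
  fixes \<rho> :: "'g \<Rightarrow> 'a::complex_vec \<Rightarrow> 'a" and \<sigma> :: "'g \<Rightarrow> 'b::complex_vec \<Rightarrow> 'b"
  assumes "\<And>X. X \<in> \<gg> \<Longrightarrow> clinear (\<sigma> X)"
  shows "cvec.subspace (rep_hom \<gg> \<rho> \<sigma>)"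
proof -
  have "\<sigma> X 0 = 0" if "X \<in> \<gg>" for X
    using assms[OF that] by (metis clinear_iff cvec.scale_zero_left)
  then show ?thesis
    using assms
    by (auto simp: cvec.subspace_def rep_hom_def clinear_iff scaleC_fun_def algebra_simps
        scaleC_add_right scaleC_scaleC)
qed


section \<open>Subalgebras of sl(3) and their characters\<close>

type_synonym mat3 = "complex ^ 3 ^ 3"

definition E :: "3 \<Rightarrow> 3 \<Rightarrow> mat3" where
  "E i j = (\<chi> k l. if k = i \<and> l = j then 1 else 0)"

definition lie :: "mat3 \<Rightarrow> mat3 \<Rightarrow> mat3" where
  "lie X Y = X ** Y - Y ** X"

definition a_sl :: "mat3 set" where
  "a_sl = {X. (\<forall>i j. i \<noteq> j \<longrightarrow> X $ i $ j = 0) \<and> (\<Sum>i\<in>UNIV. X $ i $ i) = 0}"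

text \<open>The index type \<open>3\<close> is ordered with \<open>3 = 0\<close> as its least element,
  so the positions below the diagonal are listed explicitly.\<close>

definition n_minus :: "mat3 set" where
  "n_minus = {X. \<forall>i j. (i, j) \<notin> {(2, 1), (3, 1), (3, 2)} \<longrightarrow> X $ i $ j = 0}"

definition a'_sl3 :: "mat3 set" where
  "a'_sl3 = {z *\<^sub>C (E 1 1 - E 3 3) | z. True}"

definition n'_3_minus :: "mat3 set" where
  "n'_3_minus = {z *\<^sub>C E 3 1 | z. True}"

definition char_sl :: "complex ^ 2 \<Rightarrow> mat3 \<Rightarrow> complex" where
  "char_sl u X = (THE c. \<exists>z\<^sub>1 z\<^sub>2. X = z\<^sub>1 *\<^sub>C (E 1 1 - E 2 2) + z\<^sub>2 *\<^sub>C (E 2 2 - E 3 3) \<and>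
    c = u $ 1 * z\<^sub>1 + u $ 2 * z\<^sub>2)"

definition char'_sl3 :: "complex \<Rightarrow> mat3 \<Rightarrow> complex" where
  "char'_sl3 v X = (THE c. \<exists>z. X = z *\<^sub>C (E 1 1 - E 3 3) \<and> c = v * z)"

lemmas mat3_simps = vec_eq_iff forall_3 E_def scaleC_complex_def

lemma char_sl:
  "char_sl u (z\<^sub>1 *\<^sub>C (E 1 1 - E 2 2) + z\<^sub>2 *\<^sub>C (E 2 2 - E 3 3)) = u $ 1 * z\<^sub>1 + u $ 2 * z\<^sub>2"
  unfolding char_sl_def by (rule the_equality) (auto simp: mat3_simps)

lemma char'_sl3: "char'_sl3 v (z *\<^sub>C (E 1 1 - E 3 3)) = v * z"
  unfolding char'_sl3_def by (rule the_equality) (auto simp: mat3_simps)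

lemma a_sl_eq: "a_sl = {z\<^sub>1 *\<^sub>C (E 1 1 - E 2 2) + z\<^sub>2 *\<^sub>C (E 2 2 - E 3 3) | z\<^sub>1 z\<^sub>2. True}"
proof (intro set_eqI iffI)
  fix X assume "X \<in> a_sl"
  then have off: "X $ i $ j = 0" if "i \<noteq> j" for i j
    using that by (simp add: a_sl_def)
  have "X $ 1 $ 1 + X $ 2 $ 2 + X $ 3 $ 3 = 0"
    using \<open>X \<in> a_sl\<close> by (simp add: a_sl_def sum_3)
  then have "X $ 2 $ 2 = - X $ 3 $ 3 - X $ 1 $ 1"
    by (simp add: algebra_simps eq_neg_iff_add_eq_0)
  then have "X = X $ 1 $ 1 *\<^sub>C (E 1 1 - E 2 2) + (- X $ 3 $ 3) *\<^sub>C (E 2 2 - E 3 3)"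
    by (simp add: mat3_simps off)
  then show "X \<in> {z\<^sub>1 *\<^sub>C (E 1 1 - E 2 2) + z\<^sub>2 *\<^sub>C (E 2 2 - E 3 3) | z\<^sub>1 z\<^sub>2. True}"
    by blast
next
  fix X assume "X \<in> {z\<^sub>1 *\<^sub>C (E 1 1 - E 2 2) + z\<^sub>2 *\<^sub>C (E 2 2 - E 3 3) | z\<^sub>1 z\<^sub>2. True}"
  then show "X \<in> a_sl"
    by (auto simp: a_sl_def mat3_simps sum_3)
qed

lemma a'_sl3_subset_a_sl: "a'_sl3 \<subseteq> a_sl"
  by (auto simp: a'_sl3_def a_sl_def mat3_simps sum_3)

lemma n_minus_subspace: "cvec.subspace n_minus"
  by (auto simp: cvec.subspace_def n_minus_def)

lemma n'_3_minus_subspace: "cvec.subspace n'_3_minus"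
proof -
  have "n'_3_minus = range (\<lambda>z. z *\<^sub>C E 3 1)" by (auto simp: n'_3_minus_def)
  also have "\<dots> = cvec.span {E 3 1}" by (rule cvec.span_singleton[symmetric])
  finally show ?thesis using cvec.subspace_span by metis
qed


section \<open>The multiplicity\<close>

definition n_quot_eq :: "mat3 \<Rightarrow> mat3 \<Rightarrow> bool" where
  "n_quot_eq X Y \<longleftrightarrow> X \<in> n_minus \<and> Y \<in> n_minus \<and> X - Y \<in> n'_3_minus"

text \<open>The quotient space \<open>n_minus / n'_3_minus\<close>.\<close>

quotient_type n_quot = mat3 / partial: n_quot_eq
proof (rule part_equivpI)
  show "\<exists>X. n_quot_eq X X"
    by (rule exI[of _ 0])
      (simp add: n_quot_eq_def cvec.subspace_0 n_minus_subspace n'_3_minus_subspace)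
  show "symp n_quot_eq"
    by (rule sympI) (metis n_quot_eq_def minus_diff_eq cvec.subspace_neg n'_3_minus_subspace)
  show "transp n_quot_eq"
  proof (rule transpI)
    fix X Y Z assume "n_quot_eq X Y" "n_quot_eq Y Z"
    then show "n_quot_eq X Z"
      using cvec.subspace_add[OF n'_3_minus_subspace, of "X - Y" "Y - Z"]
      by (simp add: n_quot_eq_def)
  qed
qed

instantiation n_quot :: complex_vec
begin

lift_definition zero_n_quot :: n_quot is 0
  by (simp add: n_quot_eq_def cvec.subspace_0 n_minus_subspace n'_3_minus_subspace)

lift_definition plus_n_quot :: "n_quot \<Rightarrow> n_quot \<Rightarrow> n_quot" is "(+)"
  unfolding n_quot_eq_def
  by (metis add_diff_add cvec.subspace_add n_minus_subspace n'_3_minus_subspace)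

lift_definition uminus_n_quot :: "n_quot \<Rightarrow> n_quot" is uminus
  unfolding n_quot_eq_def
  by (metis minus_diff_minus cvec.subspace_neg n_minus_subspace n'_3_minus_subspace)

lift_definition minus_n_quot :: "n_quot \<Rightarrow> n_quot \<Rightarrow> n_quot" is "(-)"
proof -
  fix X X' Y Y'
  assume "n_quot_eq X X'" "n_quot_eq Y Y'"
  moreover have "X - Y - (X' - Y') = (X - X') - (Y - Y')" by simp
  ultimately show "n_quot_eq (X - Y) (X' - Y')"
    unfolding n_quot_eq_def by (metis cvec.subspace_diff n_minus_subspace n'_3_minus_subspace)
qed

lift_definition scaleC_n_quot :: "complex \<Rightarrow> n_quot \<Rightarrow> n_quot" is scaleC
  unfolding n_quot_eq_def
  by (metis cvec.scale_right_diff_distrib cvec.subspace_scale n_minus_subspace n'_3_minus_subspace)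

instance
proof
  fix X Y Z :: n_quot and a b :: complex
  note [simp] = n_quot_eq_def cvec.subspace_0[OF n'_3_minus_subspace]
    cvec.subspace_0[OF n_minus_subspace]
    cvec.subspace_add[OF n_minus_subspace] cvec.subspace_neg[OF n_minus_subspace]
    cvec.subspace_diff[OF n_minus_subspace] cvec.subspace_scale[OF n_minus_subspace]
  show "X + Y + Z = X + (Y + Z)" by transfer (simp add: add.assoc)
  show "X + Y = Y + X" by transfer (simp add: add.commute)
  show "0 + X = X" by transfer simp
  show "- X + X = 0" by transfer simp
  show "X - Y = X + - Y" by transfer simp
  show "a *\<^sub>C (X + Y) = a *\<^sub>C X + a *\<^sub>C Y" by transfer (simp add: scaleC_add_right)
  show "(a + b) *\<^sub>C X = a *\<^sub>C X + b *\<^sub>C X" by transfer (simp add: scaleC_add_left)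
  show "a *\<^sub>C b *\<^sub>C X = (a * b) *\<^sub>C X" by transfer (simp add: scaleC_scaleC)
  show "1 *\<^sub>C X = X" by transfer (simp add: scaleC_one)
qed

end

text \<open>The adjoint action of \<open>a'_sl3\<close> on the quotient, defined on representatives;
  \<open>ad_n_quot_abs\<close> below shows that it does not depend on their choice.\<close>

definition ad_n_quot :: "mat3 \<Rightarrow> n_quot \<Rightarrow> n_quot" where
  "ad_n_quot H x = abs_n_quot (lie H (rep_n_quot x))"

lemma lie_scaleC_entry:
  "lie (z *\<^sub>C (E 1 1 - E 3 3)) X $ i $ j
    = z * ((if i = 1 then 1 else if i = 3 then -1 else 0) - (if j = 1 then 1 else if j = 3 then -1 else 0))
      * X $ i $ j"
  using exhaust_3[of i] exhaust_3[of j]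
  by (elim disjE) (simp_all add: lie_def matrix_matrix_mult_def sum_3 E_def scaleC_complex_def)

lemma ad_n_quot_abs:
  assumes "H \<in> a'_sl3" "X \<in> n_minus"
  shows "lie H X \<in> n_minus" and "ad_n_quot H (abs_n_quot X) = abs_n_quot (lie H X)"
proof -
  obtain z where H: "H = z *\<^sub>C (E 1 1 - E 3 3)" using assms(1) by (auto simp: a'_sl3_def)
  have n: "lie H Y \<in> n_minus" if "Y \<in> n_minus" for Y
    using that by (auto simp: n_minus_def H lie_scaleC_entry)
  have n': "lie H Y \<in> n'_3_minus" if Y: "Y \<in> n'_3_minus" for Y
  proof -
    obtain y where y: "Y = y *\<^sub>C E 3 1" using Y by (auto simp: n'_3_minus_def)
    have "lie H Y = (- 2 * z) *\<^sub>C Y"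
      unfolding vec_eq_iff H lie_scaleC_entry forall_3 scaleC_vec_nth y
      by (simp add: E_def scaleC_complex_def)
    then show ?thesis using cvec.subspace_scale[OF n'_3_minus_subspace Y] by (simp only:)
  qed
  have diff: "lie H Y - lie H Z = lie H (Y - Z)" for Y Z
    unfolding vec_eq_iff H vector_minus_component lie_scaleC_entry by (simp add: algebra_simps)
  show "lie H X \<in> n_minus" using n assms(2) .
  have XX: "n_quot_eq X X"
    using assms(2) by (simp add: n_quot_eq_def cvec.subspace_0 n'_3_minus_subspace)
  have "n_quot_eq (rep_n_quot (abs_n_quot X)) X"
    using XX by (metis Quotient3_n_quot rep_abs_rsp_left)
  then have "n_quot_eq (lie H (rep_n_quot (abs_n_quot X))) (lie H X)"
    using n n' by (simp add: n_quot_eq_def diff)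
  then show "ad_n_quot H (abs_n_quot X) = abs_n_quot (lie H X)"
    unfolding ad_n_quot_def by (rule Quotient3_rel_abs[OF Quotient3_n_quot])
qed

lemma abs_n_quot_cases:
  obtains X where "X \<in> n_minus" "x = abs_n_quot X"
  by (metis Quotient3_abs_rep Quotient3_n_quot Quotient3_rep_reflp n_quot_eq_def)

lemma clinear_ad_n_quot:
  assumes H: "H \<in> a'_sl3"
  shows "clinear (ad_n_quot H)"
proof -
  have refl: "n_quot_eq X X" if "X \<in> n_minus" for X
    using that by (simp add: n_quot_eq_def cvec.subspace_0 n'_3_minus_subspace)
  obtain z where Hz: "H = z *\<^sub>C (E 1 1 - E 3 3)" using H by (auto simp: a'_sl3_def)
  have lie_add: "lie H (X + Y) = lie H X + lie H Y" and lie_scale: "lie H (c *\<^sub>C X) = c *\<^sub>C lie H X"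
    for X Y c
    unfolding vec_eq_iff Hz vector_add_component scaleC_vec_nth lie_scaleC_entry
    by (simp_all add: scaleC_complex_def algebra_simps)
  have "ad_n_quot H (x + y) = ad_n_quot H x + ad_n_quot H y" for x y
  proof (cases x rule: abs_n_quot_cases; cases y rule: abs_n_quot_cases)
    fix X Y assume *: "X \<in> n_minus" "x = abs_n_quot X" "Y \<in> n_minus" "y = abs_n_quot Y"
    then show ?thesis
      by (simp add: plus_n_quot.abs_eq refl ad_n_quot_abs H lie_add
          cvec.subspace_add[OF n_minus_subspace])
  qed
  moreover have "ad_n_quot H (c *\<^sub>C x) = c *\<^sub>C ad_n_quot H x" for c x
    by (cases x rule: abs_n_quot_cases)
      (simp add: scaleC_n_quot.abs_eq refl ad_n_quot_abs H lie_scale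
          cvec.subspace_scale[OF n_minus_subspace])
  ultimately show ?thesis by (simp add: clinear_iff)
qed

text \<open>The multiplicity \<open>m(v;u)\<close>. Note that \<open>cvec.dim\<close> is \<open>0\<close> for infinite-dimensional spaces,
  so a positive value includes the assertion that the space is finite-dimensional.\<close>

definition m_sl3 :: "complex \<Rightarrow> complex ^ 2 \<Rightarrow> nat" where
  "m_sl3 v u = cvec.dim (rep_hom a'_sl3
    (char_rep (char'_sl3 v))
    (\<lambda>H. tensor_act (char_rep (char_sl u) H) (sym_act (ad_n_quot H))))"

end

theory Submission
  imports Defs
begin

text \<open>
  Modulo \<open>E 3 1\<close>, the space \<open>n_minus\<close> is a plane with basis \<open>E 2 1\<close>, \<open>E 3 2\<close>. The roots of these two
  vectors agree on \<open>H = E 1 1 - E 3 3\<close>: both take the value \<open>-1\<close>. So \<open>H\<close> acts on the plane as the scalar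
  \<open>-1\<close>, and on its symmetric algebra, which is a polynomial ring in two variables, it acts as minus
  the degree. Twisting by the character \<open>u\<close>, whose value at \<open>H\<close> is \<open>u $ 1 + u $ 2\<close>, shifts these
  eigenvalues. The homomorphisms from the character \<open>v = u $ 1 + u $ 2 - d\<close> are therefore the
  homogeneous polynomials of degree \<open>d\<close>, a space of dimension \<open>d + 1\<close>, and \<open>d = k - 1\<close> gives the
  multiplicity \<open>k\<close>.

  The symmetric algebra is a quotient by an ideal, so the linear independence of the monomials in a
  basis has to be proved. Every linear functional on the generating space extends to a character of
  the algebra (\<open>sym_alg_character\<close>); applied to a vanishing linear combination of monomials, the
  characters give a polynomial function in two variables that vanishes identically, so all the
  coefficients vanish (\<open>monomials_independent\<close>). With this and the spanning property, the eigenspaces of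
  a scalar acting by derivations are the homogeneous parts (\<open>sym_act_scalar_homogeneous\<close>,
  \<open>homogeneous_if_eigenvector\<close>). The rest transports this computation through the tensor product with
  the ground field (\<open>rep_hom_eq_homogeneous_part\<close>).
\<close>

section \<open>Characters of a symmetric algebra\<close>

text \<open>This is the universal property of the symmetric algebra with the ground field as target: the
  product of the values of \<open>\<phi>\<close> over a multiset defines a ring homomorphism on the polynomial ring,
  and it kills the linear relations because \<open>\<phi>\<close> is linear.\<close>

lemma sym_alg_character:
  fixes \<phi> :: "'v::complex_vec \<Rightarrow> complex"
  assumes \<phi>: "clinear \<phi>"
  obtains \<epsilon> :: "'v sym_alg \<Rightarrow> complex" where "clinear \<epsilon>" "\<epsilon> 1 = 1"
    "\<And>x y. \<epsilon> (x * y) = \<epsilon> x * \<epsilon> y" "\<And>v. \<epsilon> (sym_gen v) = \<phi> v"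
proof -
  let ?F = "lin_ext (\<lambda>m. prod_mset (image_mset \<phi> m))"
  have F_0: "?F 0 = 0" by (simp add: lin_ext_def)
  have F_diff: "?F (p - q) = ?F p - ?F q" for p q
    using clinear_lin_ext by (rule module_hom.diff[OF Vector_Spaces.linear.axioms(3)])
  have F_single_mult: "?F (Poly_Mapping.single m c * q) = ?F (Poly_Mapping.single m c) * ?F q"
    for m c q
    by (induction q rule: poly_mapping_add_induct)
      (simp_all add: F_0 mult_single scaleC_complex_def lin_ext_add distrib_left)
  have F_mult: "?F (p * q) = ?F p * ?F q" for p q
    by (induction p rule: poly_mapping_add_induct)
      (simp_all add: F_0 F_single_mult lin_ext_add distrib_right del: lin_ext_single)
  have F_rels: "?F r = 0" if "r \<in> sym_rels" for r
    using that \<phi> by (auto simp: sym_rels_def F_diff lin_ext_scaleC clinear_iff scaleC_one)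
  have F_ideal: "?F p = 0" if "p \<in> ideal_gen sym_rels" for p
    using that by (induction rule: ideal_gen_induct) (simp_all add: F_0 lin_ext_add F_mult F_rels)
  define \<epsilon> where "\<epsilon> x = ?F (rep_sym_alg x)" for x
  have \<epsilon>_abs: "\<epsilon> (abs_sym_alg p) = ?F p" for p
  proof -
    have "sym_eq (rep_sym_alg (abs_sym_alg p)) p"
      by (simp add: sym_alg.abs_eq_iff[symmetric] Quotient3_abs_rep[OF Quotient3_sym_alg])
    then have "?F (rep_sym_alg (abs_sym_alg p) - p) = 0"
      unfolding sym_eq_def by (rule F_ideal)
    then show ?thesis by (simp add: \<epsilon>_def F_diff)
  qed
  have "\<epsilon> (x + y) = \<epsilon> x + \<epsilon> y" for x y
    by (cases x rule: abs_sym_alg_cases; cases y rule: abs_sym_alg_cases)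
      (simp add: plus_sym_alg.abs_eq \<epsilon>_abs lin_ext_add)
  moreover have "\<epsilon> (c *\<^sub>C x) = c *\<^sub>C \<epsilon> x" for c x
    by (cases x rule: abs_sym_alg_cases) (simp add: scaleC_sym_alg.abs_eq \<epsilon>_abs lin_ext_scaleC)
  ultimately have "clinear \<epsilon>" by (simp add: clinear_iff)
  moreover have "\<epsilon> 1 = 1"
    by (simp add: one_sym_alg.abs_eq \<epsilon>_abs scaleC_complex_def flip: single_one zero_multiset_def)
  moreover have "\<epsilon> (x * y) = \<epsilon> x * \<epsilon> y" for x y
    by (cases x rule: abs_sym_alg_cases; cases y rule: abs_sym_alg_cases)
      (simp add: times_sym_alg.abs_eq \<epsilon>_abs F_mult)
  moreover have "\<epsilon> (sym_gen v) = \<phi> v" for v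
    by (simp add: sym_gen.abs_eq \<epsilon>_abs scaleC_complex_def)
  ultimately show ?thesis by (rule that)
qed

section \<open>The symmetric algebra of a plane\<close>

lemma clinear_scaleC: "clinear (\<lambda>v::'v::complex_vec. c *\<^sub>C v)"
  by (simp add: clinear_iff scaleC_add_right scaleC_scaleC mult.commute)

text \<open>The dual basis \<open>a\<close>, \<open>b\<close> is carried along with the basis, since monomials are told apart by
  evaluating them at linear functionals on the plane.\<close>

locale plane_basis =
  fixes e\<^sub>1 e\<^sub>2 :: "'v::complex_vec" and a b :: "'v \<Rightarrow> complex"
  assumes a: "clinear a" and b: "clinear b"
    and expand: "v = a v *\<^sub>C e\<^sub>1 + b v *\<^sub>C e\<^sub>2"
    and dual: "a e\<^sub>1 = 1" "a e\<^sub>2 = 0" "b e\<^sub>1 = 0" "b e\<^sub>2 = 1"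
begin

definition monomial :: "nat \<times> nat \<Rightarrow> 'v sym_alg" where
  "monomial = (\<lambda>(i, j). sym_gen e\<^sub>1 ^ i * sym_gen e\<^sub>2 ^ j)"

lemma sym_gen_monomial:
  "sym_gen e\<^sub>1 * monomial (i, j) = monomial (Suc i, j)"
  "sym_gen e\<^sub>2 * monomial (i, j) = monomial (i, Suc j)"
  by (simp_all add: monomial_def mult_ac)

text \<open>The functional \<open>s a + t b\<close> on the plane induces a character that takes the monomial \<open>(i, j)\<close> to
  \<open>s ^ i * t ^ j\<close>. A linear relation thus becomes a polynomial identity in \<open>s\<close> and \<open>t\<close>, whose
  coefficients are zero by two applications of the one-variable case.\<close>

lemma monomials_independent:
  assumes A: "finite A" and zero: "(\<Sum>k\<in>A. c k *\<^sub>C monomial k) = 0" and k: "k \<in> A"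
  shows "c k = 0"
proof -
  obtain n where n: "A \<subseteq> {..n} \<times> {..n}"
  proof -
    have "finite (fst ` A \<union> snd ` A)" using A by simp
    then obtain n where n: "fst ` A \<union> snd ` A \<subseteq> {..n}"
      unfolding finite_nat_iff_bounded_le by blast
    show ?thesis by (rule that[of n]) (use n in force)
  qed
  \<comment> \<open>Padding by zeros turns the sum over \<open>A\<close> into one over a square, where the two variables separate.\<close>
  define c' where "c' i j = (if (i, j) \<in> A then c (i, j) else 0)" for i j
  have poly_zero: "(\<Sum>i\<le>n. (\<Sum>j\<le>n. c' i j * t ^ j) * s ^ i) = 0" for s t
  proof -
    have "clinear (\<lambda>v. s * a v + t * b v)"
      using a b by (simp add: clinear_iff scaleC_complex_def algebra_simps)
    then obtain \<epsilon> :: "'v sym_alg \<Rightarrow> complex" where \<epsilon>: "clinear \<epsilon>" "\<epsilon> 1 = 1"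
      "\<And>x y. \<epsilon> (x * y) = \<epsilon> x * \<epsilon> y" "\<And>v. \<epsilon> (sym_gen v) = s * a v + t * b v"
      by (rule sym_alg_character) blast
    have pow: "\<epsilon> (x ^ i) = \<epsilon> x ^ i" for x i
      by (induction i) (simp_all add: \<epsilon>)
    have mono: "\<epsilon> (monomial (i, j)) = s ^ i * t ^ j" for i j
      by (simp add: monomial_def \<epsilon> pow dual)
    interpret \<epsilon>: Vector_Spaces.linear scaleC scaleC \<epsilon> by (fact \<epsilon>)
    have "0 = \<epsilon> (\<Sum>k\<in>A. c k *\<^sub>C monomial k)" using zero by (simp add: \<epsilon>.zero)
    also have "\<dots> = (\<Sum>(i, j)\<in>A. c (i, j) * (s ^ i * t ^ j))"
      unfolding \<epsilon>.sum \<epsilon>.scale by (rule sum.cong) (auto simp: mono scaleC_complex_def)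
    also have "\<dots> = (\<Sum>(i, j)\<in>{..n} \<times> {..n}. c' i j * (s ^ i * t ^ j))"
      using n by (intro sum.mono_neutral_cong_left) (auto simp: c'_def)
    also have "\<dots> = (\<Sum>i\<le>n. (\<Sum>j\<le>n. c' i j * t ^ j) * s ^ i)"
      unfolding sum.cartesian_product[symmetric] sum_distrib_right by (simp add: mult_ac)
    finally show ?thesis by simp
  qed
  obtain i j where ij: "k = (i, j)" by fastforce
  with k n have le: "i \<le> n" "j \<le> n" by auto
  have "(\<Sum>j\<le>n. c' i j * t ^ j) = 0" for t
    using poly_zero[of t] le(1) polyfun_eq_0[of "\<lambda>i. \<Sum>j\<le>n. c' i j * t ^ j" n] by simp
  then have "c' i j = 0"
    using le(2) polyfun_eq_0[of "c' i" n] by simp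
  then show ?thesis using k ij by (simp add: c'_def)
qed

lemma inj_monomial: "inj monomial"
proof (rule injI, rule ccontr)
  fix k l assume *: "monomial k = monomial l" "k \<noteq> l"
  have "(if k = k then 1 else - 1 :: complex) = 0"
    by (rule monomials_independent[of "{k, l}" "\<lambda>m. if m = k then 1 else - 1" k])
      (use * in \<open>auto simp: scaleC_one\<close>)
  then show False by simp
qed

lemma monomials_span: "cvec.span (range monomial) = UNIV"
proof -
  have gen: "sym_gen v * x \<in> cvec.span (range monomial)"
    if x: "x \<in> cvec.span (range monomial)" for v x
  proof -
    have "sym_gen e * x \<in> cvec.span (range monomial)"
      if e: "e = e\<^sub>1 \<or> e = e\<^sub>2" for e
      using x
    proof (induction rule: cvec.span_induct_alt)
      case base
      then show ?case by (simp add: cvec.span_zero)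
    next
      case (step c x y)
      then obtain i j where "x = monomial (i, j)" by auto
      then have "sym_gen e * x \<in> range monomial" using e sym_gen_monomial by auto
      with step show ?case
        by (simp add: distrib_left sym_scaleC_mult cvec.span_add cvec.span_scale cvec.span_base)
    qed
    moreover have "sym_gen v * x = a v *\<^sub>C (sym_gen e\<^sub>1 * x) + b v *\<^sub>C (sym_gen e\<^sub>2 * x)"
      by (subst expand) (simp add: sym_gen_linear sym_scaleC_mult distrib_right)
    ultimately show ?thesis by (simp add: cvec.span_add cvec.span_scale)
  qed
  have "x \<in> cvec.span (range monomial)" for x
  proof (induction x rule: sym_alg_induct)
    case one
    have "1 = monomial (0, 0)" by (simp add: monomial_def)
    then show ?case by (metis cvec.span_base rangeI)
  qed (simp_all add: gen cvec.span_add cvec.span_scale)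
  then show ?thesis by blast
qed

text \<open>Euler's formula: a derivation that is the scalar \<open>c\<close> on generators adds up \<open>c\<close> once for each
  factor of a monomial.\<close>

lemma sym_act_scalar_monomial:
  fixes c :: complex
  defines "D \<equiv> sym_act (\<lambda>v::'v. c *\<^sub>C v)"
  shows "D (monomial (i, j)) = (of_nat (i + j) * c) *\<^sub>C monomial (i, j)"
proof -
  have "clinear (\<lambda>v::'v. c *\<^sub>C v)" by (rule clinear_scaleC)
  note D = sym_act[OF this, folded D_def]
  have step: "D (sym_gen v * x) = (of_nat (Suc n) * c) *\<^sub>C (sym_gen v * x)"
    if "D x = (of_nat n * c) *\<^sub>C x" for v x n
    by (simp add: D that sym_gen_linear sym_scaleC_mult distrib_right scaleC_add_left)
  have "D 1 = 0" using D(2)[of 1 1] by simp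
  show ?thesis
  proof (induction i)
    case 0
    show ?case
    proof (induction j)
      case 0
      then show ?case using \<open>D 1 = 0\<close> by (simp add: monomial_def)
    next
      case (Suc j)
      from step[OF this, of e\<^sub>2] show ?case by (simp add: sym_gen_monomial)
    qed
  next
    case (Suc i)
    from step[OF this, of e\<^sub>1] show ?case by (simp add: sym_gen_monomial)
  qed
qed

definition homogeneous_part :: "nat \<Rightarrow> 'v sym_alg set" where
  "homogeneous_part d = cvec.span ((\<lambda>i. monomial (i, d - i)) ` {..d})"

lemma sym_act_scalar_homogeneous:
  assumes "x \<in> homogeneous_part d"
  shows "sym_act (\<lambda>v::'v. c *\<^sub>C v) x = (of_nat d * c) *\<^sub>C x"
proof -
  interpret D: Vector_Spaces.linear scaleC scaleC "sym_act (\<lambda>v::'v. c *\<^sub>C v)"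
    by (rule sym_act(1)[OF clinear_scaleC])
  from assms show ?thesis unfolding homogeneous_part_def
    by (induction rule: cvec.span_induct_alt)
      (auto simp: D.zero D.add D.scale sym_act_scalar_monomial scaleC_add_right scaleC_scaleC mult_ac)
qed

text \<open>The eigenvalue equation, written out in monomials, multiplies the coefficient of \<open>(i, j)\<close> by
  \<open>(i + j - d) * c\<close>; by independence only the monomials with \<open>i + j = d\<close> can occur.\<close>

lemma homogeneous_if_eigenvector:
  assumes eig: "sym_act (\<lambda>v::'v. c *\<^sub>C v) x = (of_nat d * c) *\<^sub>C x" and c: "c \<noteq> 0"
  shows "x \<in> homogeneous_part d"
proof -
  interpret D: Vector_Spaces.linear scaleC scaleC "sym_act (\<lambda>v::'v. c *\<^sub>C v)"
    by (rule sym_act(1)[OF clinear_scaleC])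
  have "x \<in> cvec.span (range monomial)" by (simp add: monomials_span)
  then obtain t r where t: "finite t" "t \<subseteq> range monomial" and x: "x = (\<Sum>m\<in>t. r m *\<^sub>C m)"
    unfolding cvec.span_explicit by blast
  from t(2) obtain A where A: "inj_on monomial A" "t = monomial ` A"
    unfolding subset_image_inj by blast
  define q where "q k = r (monomial k)" for k
  have finA: "finite A" using t(1) A finite_imageD by blast
  have x: "x = (\<Sum>k\<in>A. q k *\<^sub>C monomial k)"
    unfolding x A(2) by (simp add: sum.reindex[OF A(1)] q_def)
  have D_monomial: "sym_act (\<lambda>v::'v. c *\<^sub>C v) (monomial k) = (of_nat (fst k + snd k) * c) *\<^sub>C monomial k"
    for k using sym_act_scalar_monomial[of c "fst k" "snd k"] by simp
  have "(\<Sum>k\<in>A. (q k * (of_nat (fst k + snd k) - of_nat d) * c) *\<^sub>C monomial k)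
      = (\<Sum>k\<in>A. q k *\<^sub>C sym_act (\<lambda>v::'v. c *\<^sub>C v) (monomial k)
          - (of_nat d * c) *\<^sub>C q k *\<^sub>C monomial k)"
  proof (rule sum.cong[OF refl])
    fix k
    have "q k * (of_nat (fst k + snd k) - of_nat d) * c
        = q k * (of_nat (fst k + snd k) * c) - of_nat d * c * q k"
      by (simp add: algebra_simps)
    then show "(q k * (of_nat (fst k + snd k) - of_nat d) * c) *\<^sub>C monomial k
        = q k *\<^sub>C sym_act (\<lambda>v::'v. c *\<^sub>C v) (monomial k)
          - (of_nat d * c) *\<^sub>C q k *\<^sub>C monomial k"
      by (simp only: D_monomial scaleC_scaleC cvec.scale_left_diff_distrib)
  qed
  also have "\<dots> = sym_act (\<lambda>v::'v. c *\<^sub>C v) x - (of_nat d * c) *\<^sub>C x"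
    unfolding x by (simp only: sum_subtractf D.sum D.scale cvec.scale_sum_right)
  also have "\<dots> = 0" using eig by (simp only: diff_self)
  finally have "(\<Sum>k\<in>A. (q k * (of_nat (fst k + snd k) - of_nat d) * c) *\<^sub>C monomial k) = 0" .
  from monomials_independent[OF finA this]
  have q: "q k = 0 \<or> fst k + snd k = d" if "k \<in> A" for k
    using that c by (auto simp flip: of_nat_add)
  have "q k *\<^sub>C monomial k \<in> homogeneous_part d" if "k \<in> A" for k
  proof (cases "q k = 0")
    case True
    then show ?thesis by (simp add: homogeneous_part_def cvec.span_zero)
  next
    case False
    with q[OF that] have "fst k \<le> d" "k = (fst k, d - fst k)" by (auto simp: prod_eq_iff)
    then have "monomial k \<in> (\<lambda>i. monomial (i, d - i)) ` {..d}"
      using arg_cong[of k _ monomial] by (intro image_eqI[of _ _ "fst k"]) simp_all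
    then show ?thesis unfolding homogeneous_part_def by (intro cvec.span_scale cvec.span_base)
  qed
  then show ?thesis unfolding x homogeneous_part_def by (rule cvec.span_sum)
qed

text \<open>The form with an injective linear map serves for a space of linear maps that is only
  isomorphic to the homogeneous part.\<close>

lemma dim_injective_image_homogeneous_part:
  assumes G: "clinear G" and inj: "inj G"
  shows "cvec.dim (G ` homogeneous_part d) = d + 1"
proof -
  interpret G: Vector_Spaces.linear scaleC scaleC G by (fact G)
  let ?m = "\<lambda>i. monomial (i, d - i)"
  let ?B = "?m ` {..d}"
  have inj_m: "inj_on ?m {..d}"
    by (rule inj_onI) (use inj_monomial in \<open>auto dest: injD\<close>)
  have "cvec.independent ?B"
  proof -
    have "u v = 0" if u: "(\<Sum>v\<in>?B. u v *\<^sub>C v) = 0" and v: "v \<in> ?B" for u v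
    proof -
      from v obtain i where i: "i \<le> d" "v = ?m i" by auto
      have "inj_on (\<lambda>i. (i, d - i)) {..d}" by (auto simp: inj_on_def)
      then have "(\<Sum>k\<in>(\<lambda>i. (i, d - i)) ` {..d}. u (monomial k) *\<^sub>C monomial k) = 0"
        using u by (simp add: sum.reindex[OF inj_m] sum.reindex)
      from monomials_independent[OF _ this, of "(i, d - i)"] i show ?thesis by simp
    qed
    then show ?thesis unfolding cvec.dependent_finite[OF finite_imageI[OF finite_atMost]] by blast
  qed
  then have "cvec.independent (G ` ?B)"
    using inj G.independent_injective_image by (metis inj_on_subset subset_UNIV)
  then have "cvec.dim (cvec.span (G ` ?B)) = card (G ` ?B)"
    by (rule cvec.dim_span_eq_card_independent)
  also have "\<dots> = d + 1"
    using card_image[OF inj_on_subset[OF inj subset_UNIV], of ?B] card_image[OF inj_m] by simp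
  finally show ?thesis unfolding homogeneous_part_def G.span_image .
qed

end

section \<open>Tensoring with the ground field\<close>

text \<open>The map \<open>z \<otimes>\<^sub>C x \<mapsto> z *\<^sub>C x\<close> is a left inverse of \<open>x \<mapsto> 1 \<otimes>\<^sub>C x\<close>.\<close>

lemma tensor_one_eq_iff: "(1::complex) \<otimes>\<^sub>C x = 1 \<otimes>\<^sub>C y \<longleftrightarrow> x = y"
proof -
  have "\<exists>!T. clinear T \<and> (\<forall>z x. T (z \<otimes>\<^sub>C x) = z *\<^sub>C (x::'a))"
    by (rule tensor_lift) (simp_all add: clinear_iff scaleC_complex_def scaleC_add_right
        scaleC_add_left scaleC_scaleC mult.commute)
  then obtain T where "\<And>z x. T (z \<otimes>\<^sub>C x) = z *\<^sub>C (x::'a)" by blast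
  then have "T (1 \<otimes>\<^sub>C x) = x" "T (1 \<otimes>\<^sub>C y) = y" by (simp_all add: scaleC_one)
  then show ?thesis by metis
qed

lemma tensor_complex_cases:
  fixes t :: "(complex, 'a::complex_vec) tensor"
  obtains x where "t = 1 \<otimes>\<^sub>C x"
proof -
  have "\<exists>x. t = 1 \<otimes>\<^sub>C x"
  proof (induction t rule: tensor_induct)
    case zero
    have "1 \<otimes>\<^sub>C 0 = (0 :: (complex, 'a) tensor)"
      using tensor_bilinear(4)[of 1 0 0] by simp
    then show ?case by metis
  next
    case (tensor z x)
    have "z \<otimes>\<^sub>C x = 1 \<otimes>\<^sub>C (z *\<^sub>C x)"
      using tensor_bilinear(3)[of z "1 :: complex" x] tensor_bilinear(4)[of "1 :: complex" z x]
      by (simp add: scaleC_complex_def[of z 1])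
    then show ?case by blast
  next
    case (add s t)
    then show ?case by (metis tensor_bilinear(2))
  qed
  with that show ?thesis by blast
qed

section \<open>The quotient space and its weights\<close>

lemma abs_n_quot_eq_iff:
  assumes "X \<in> n_minus" "Y \<in> n_minus"
  shows "abs_n_quot X = abs_n_quot Y \<longleftrightarrow> X - Y \<in> n'_3_minus"
  using Quotient3_rel[OF Quotient3_n_quot, of X Y] assms
  by (simp add: n_quot_eq_def cvec.subspace_0 n'_3_minus_subspace)

lemma n_minus_eqv: "X \<in> n_minus \<Longrightarrow> n_quot_eq X X"
  by (simp add: n_quot_eq_def cvec.subspace_0 n'_3_minus_subspace)

text \<open>Two representatives of a class differ only in the entry \<open>(3, 1)\<close>, so every other entry is a
  well-defined coordinate on the quotient.\<close>

lemma rep_abs_n_quot_entry: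
  assumes X: "X \<in> n_minus" and ij: "(i, j) \<noteq> (3, 1)"
  shows "rep_n_quot (abs_n_quot X) $ i $ j = X $ i $ j"
proof -
  have "n_quot_eq (rep_n_quot (abs_n_quot X)) X"
    using n_minus_eqv[OF X] by (metis Quotient3_n_quot rep_abs_rsp_left)
  then obtain z where "rep_n_quot (abs_n_quot X) - X = z *\<^sub>C E 3 1"
    by (auto simp: n_quot_eq_def n'_3_minus_def)
  then have "(rep_n_quot (abs_n_quot X) - X) $ i $ j = (z *\<^sub>C E 3 1) $ i $ j" by (simp only:)
  with ij show ?thesis by (auto simp: E_def scaleC_complex_def)
qed

interpretation n_quot: plane_basis "abs_n_quot (E 2 1)" "abs_n_quot (E 3 2)"
  "\<lambda>q. rep_n_quot q $ 2 $ 1" "\<lambda>q. rep_n_quot q $ 3 $ 2"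
proof (rule plane_basis.intro)
  have E: "E 2 1 \<in> n_minus" "E 3 2 \<in> n_minus" by (auto simp: n_minus_def E_def)
  have lin: "clinear (\<lambda>q. rep_n_quot q $ i $ j)" if "(i, j) \<noteq> (3, 1)" for i j
    unfolding clinear_iff
  proof (intro conjI allI)
    fix x y :: n_quot and c
    obtain X Y where *: "X \<in> n_minus" "x = abs_n_quot X" "Y \<in> n_minus" "y = abs_n_quot Y"
      by (metis abs_n_quot_cases)
    show "rep_n_quot (x + y) $ i $ j = rep_n_quot x $ i $ j + rep_n_quot y $ i $ j"
      using * that by (simp add: plus_n_quot.abs_eq n_minus_eqv rep_abs_n_quot_entry
          cvec.subspace_add[OF n_minus_subspace])
    show "rep_n_quot (c *\<^sub>C x) $ i $ j = c *\<^sub>C rep_n_quot x $ i $ j"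
      using * that by (simp add: scaleC_n_quot.abs_eq n_minus_eqv rep_abs_n_quot_entry
          cvec.subspace_scale[OF n_minus_subspace])
  qed
  show "clinear (\<lambda>q. rep_n_quot q $ 2 $ 1)" "clinear (\<lambda>q. rep_n_quot q $ 3 $ 2)"
    by (rule lin; simp)+
  show "rep_n_quot (abs_n_quot (E 2 1)) $ 2 $ 1 = 1" "rep_n_quot (abs_n_quot (E 3 2)) $ 2 $ 1 = 0"
    "rep_n_quot (abs_n_quot (E 2 1)) $ 3 $ 2 = 0" "rep_n_quot (abs_n_quot (E 3 2)) $ 3 $ 2 = 1"
    by (simp_all add: rep_abs_n_quot_entry E) (simp_all add: E_def)
  fix v :: n_quot
  obtain X where X: "X \<in> n_minus" "v = abs_n_quot X" by (rule abs_n_quot_cases)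
  have sum_mem: "X $ 2 $ 1 *\<^sub>C E 2 1 + X $ 3 $ 2 *\<^sub>C E 3 2 \<in> n_minus"
    by (intro cvec.subspace_add cvec.subspace_scale n_minus_subspace E)
  have "X - (X $ 2 $ 1 *\<^sub>C E 2 1 + X $ 3 $ 2 *\<^sub>C E 3 2) = X $ 3 $ 1 *\<^sub>C E 3 1"
    using X(1) by (simp add: n_minus_def mat3_simps)
  then have "v = abs_n_quot (X $ 2 $ 1 *\<^sub>C E 2 1 + X $ 3 $ 2 *\<^sub>C E 3 2)"
    unfolding X(2) abs_n_quot_eq_iff[OF X(1) sum_mem] n'_3_minus_def by blast
  also have "\<dots> = X $ 2 $ 1 *\<^sub>C abs_n_quot (E 2 1) + X $ 3 $ 2 *\<^sub>C abs_n_quot (E 3 2)"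
    by (simp add: plus_n_quot.abs_eq scaleC_n_quot.abs_eq n_minus_eqv E
        cvec.subspace_scale[OF n_minus_subspace])
  finally show "v = rep_n_quot v $ 2 $ 1 *\<^sub>C abs_n_quot (E 2 1)
      + rep_n_quot v $ 3 $ 2 *\<^sub>C abs_n_quot (E 3 2)"
    using rep_abs_n_quot_entry[OF X(1), of 2 1] rep_abs_n_quot_entry[OF X(1), of 3 2] X(2)
    by simp
qed

text \<open>The entries \<open>(2, 1)\<close> and \<open>(3, 2)\<close> are both scaled by \<open>- z\<close>. The entry \<open>(3, 1)\<close> is scaled by
  \<open>- 2 * z\<close>, but it vanishes in the quotient.\<close>

lemma ad_n_quot_scalar: "ad_n_quot (z *\<^sub>C (E 1 1 - E 3 3)) = (\<lambda>x. (- z) *\<^sub>C x)"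
proof
  fix x :: n_quot
  obtain X where X: "X \<in> n_minus" "x = abs_n_quot X" by (rule abs_n_quot_cases)
  let ?H = "z *\<^sub>C (E 1 1 - E 3 3)"
  have H: "?H \<in> a'_sl3" by (auto simp: a'_sl3_def)
  have "lie ?H X - (- z) *\<^sub>C X = (- z * X $ 3 $ 1) *\<^sub>C E 3 1"
    unfolding vec_eq_iff vector_minus_component lie_scaleC_entry
    using X(1) by (simp add: n_minus_def E_def scaleC_complex_def forall_3)
  then have "lie ?H X - (- z) *\<^sub>C X \<in> n'_3_minus" unfolding n'_3_minus_def by blast
  then have "abs_n_quot (lie ?H X) = abs_n_quot ((- z) *\<^sub>C X)"
    using abs_n_quot_eq_iff ad_n_quot_abs(1)[OF H X(1)] cvec.subspace_scale[OF n_minus_subspace X(1)]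
    by blast
  also have "\<dots> = (- z) *\<^sub>C x"
    using X by (simp only: scaleC_n_quot.abs_eq n_minus_eqv)
  finally show "ad_n_quot ?H x = (- z) *\<^sub>C x"
    using X H by (simp add: ad_n_quot_abs)
qed

section \<open>The multiplicity\<close>

text \<open>A linear map from the ground field is determined by its value at \<open>1\<close>, which has the form
  \<open>1 \<otimes>\<^sub>C s\<close>. The map intertwines the two actions exactly when \<open>s\<close> is an eigenvector, and subtracting the
  contribution of \<open>u\<close> from the eigenvalue leaves \<open>- d\<close> at \<open>E 1 1 - E 3 3\<close>.\<close>

lemma rep_hom_eq_homogeneous_part:
  "rep_hom a'_sl3 (char_rep (char'_sl3 (u $ 1 + u $ 2 - of_nat d)))
     (\<lambda>H. tensor_act (char_rep (char_sl u) H) (sym_act (ad_n_quot H)))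
   = (\<lambda>s z. z *\<^sub>C (1 \<otimes>\<^sub>C s)) ` n_quot.homogeneous_part d"
  (is "rep_hom _ ?\<rho> ?\<sigma> = ?G ` _")
proof -
  define H where "H z = z *\<^sub>C (E 1 1 - E 3 3)" for z
  have a': "a'_sl3 = range H" by (auto simp: a'_sl3_def H_def)
  have ad: "ad_n_quot (H z) = (\<lambda>x. (- z) *\<^sub>C x)" for z
    by (simp add: H_def ad_n_quot_scalar)
  have char_sl_H: "char_sl u (H z) = (u $ 1 + u $ 2) * z" for z
  proof -
    have "H z = z *\<^sub>C (E 1 1 - E 2 2) + z *\<^sub>C (E 2 2 - E 3 3)"
      by (simp add: H_def flip: scaleC_add_right)
    then show ?thesis by (simp add: char_sl distrib_right)
  qed
  have \<rho>: "?\<rho> (H z) w = (u $ 1 + u $ 2 - of_nat d) * z * w" for z w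
    by (simp add: char_rep_def H_def char'_sl3)
  have lin_ad: "clinear (ad_n_quot (H z))" for z
    by (rule clinear_ad_n_quot) (simp add: a')
  have lin\<sigma>: "clinear (?\<sigma> (H z))" for z
    by (intro tensor_act(1) clinear_char_rep sym_act(1) lin_ad)
  have \<sigma>: "?\<sigma> (H z) (1 \<otimes>\<^sub>C s)
      = 1 \<otimes>\<^sub>C (((u $ 1 + u $ 2) * z) *\<^sub>C s + sym_act (\<lambda>x. (- z) *\<^sub>C x) s)" for z s
  proof -
    have "char_rep (char_sl u) (H z) 1 = ((u $ 1 + u $ 2) * z) *\<^sub>C 1"
      by (simp add: char_rep_def char_sl_H scaleC_complex_def)
    then show ?thesis
      unfolding tensor_act(2)[OF clinear_char_rep sym_act(1)[OF lin_ad]]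
      by (simp only: tensor_bilinear ad)
  qed
  have weight_iff: "(\<forall>z. ?\<sigma> (H z) (1 \<otimes>\<^sub>C s) = ((u $ 1 + u $ 2 - of_nat d) * z) *\<^sub>C (1 \<otimes>\<^sub>C s))
      \<longleftrightarrow> s \<in> n_quot.homogeneous_part d" for s
  proof -
    have *: "?\<sigma> (H z) (1 \<otimes>\<^sub>C s) = ((u $ 1 + u $ 2 - of_nat d) * z) *\<^sub>C (1 \<otimes>\<^sub>C s)
        \<longleftrightarrow> sym_act (\<lambda>x. (- z) *\<^sub>C x) s = (of_nat d * (- z)) *\<^sub>C s" for z
    proof -
      have "((u $ 1 + u $ 2 - of_nat d) * z) *\<^sub>C s
          = ((u $ 1 + u $ 2) * z) *\<^sub>C s + (of_nat d * (- z)) *\<^sub>C s"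
        by (simp add: algebra_simps flip: scaleC_add_left)
      then show ?thesis
        unfolding \<sigma> tensor_bilinear(4)[symmetric] tensor_one_eq_iff by (simp only: add_left_cancel)
    qed
    show ?thesis
      \<comment> \<open>The single element with \<open>z = 1\<close> already forces homogeneity, and then all others act correctly.\<close>
      unfolding *
    proof (intro iffI allI)
      assume "\<forall>z. sym_act (\<lambda>x. (- z) *\<^sub>C x) s = (of_nat d * (- z)) *\<^sub>C s"
      then show "s \<in> n_quot.homogeneous_part d"
        by (rule n_quot.homogeneous_if_eigenvector[OF spec[of _ 1]]) simp
    qed (rule n_quot.sym_act_scalar_homogeneous)
  qed
  show ?thesis
  proof (intro set_eqI iffI)
    fix f assume "f \<in> rep_hom a'_sl3 ?\<rho> ?\<sigma>"
    then have f: "clinear f" "\<And>z w. f (?\<rho> (H z) w) = ?\<sigma> (H z) (f w)"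
      by (auto simp: rep_hom_def a')
    obtain s where s: "f 1 = 1 \<otimes>\<^sub>C s" by (rule tensor_complex_cases)
    have f_eq: "f z = z *\<^sub>C (1 \<otimes>\<^sub>C s)" for z
      using f(1) s by (metis clinear_iff scaleC_complex_def mult.right_neutral)
    have "s \<in> n_quot.homogeneous_part d"
      unfolding weight_iff[symmetric] using f(2)[of _ 1] s by (simp add: \<rho> f_eq)
    then show "f \<in> ?G ` n_quot.homogeneous_part d" using f_eq by blast
  next
    fix f assume "f \<in> ?G ` n_quot.homogeneous_part d"
    then obtain s where s: "s \<in> n_quot.homogeneous_part d" and f: "f = ?G s" by blast
    have "clinear f"
      unfolding f by (simp add: clinear_iff scaleC_add_left scaleC_scaleC scaleC_complex_def)
    moreover have "f (?\<rho> (H z) w) = ?\<sigma> (H z) (f w)" for z w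
    proof -
      have "?\<sigma> (H z) (f w) = w *\<^sub>C ?\<sigma> (H z) (1 \<otimes>\<^sub>C s)"
        unfolding f using lin\<sigma>[of z] by (simp add: clinear_iff)
      also have "\<dots> = w *\<^sub>C ((u $ 1 + u $ 2 - of_nat d) * z) *\<^sub>C (1 \<otimes>\<^sub>C s)"
        using weight_iff s by metis
      finally show ?thesis unfolding f \<rho> by (simp add: scaleC_scaleC mult_ac)
    qed
    ultimately show "f \<in> rep_hom a'_sl3 ?\<rho> ?\<sigma>"
      by (auto simp: rep_hom_def a')
  qed
qed

lemma m_sl3_eq: "m_sl3 (u $ 1 + u $ 2 - of_nat d) u = d + 1"
proof -
  let ?G = "\<lambda>(s :: n_quot sym_alg) (z :: complex). z *\<^sub>C ((1 :: complex) \<otimes>\<^sub>C s)"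
  have "clinear ?G"
    by (auto simp: clinear_iff fun_eq_iff scaleC_fun_def tensor_bilinear scaleC_add_right
        scaleC_scaleC mult.commute)
  moreover have "inj ?G"
  proof (rule injI)
    fix s t assume "?G s = ?G t"
    from fun_cong[OF this, of 1] show "s = t" by (simp add: scaleC_one tensor_one_eq_iff)
  qed
  ultimately show ?thesis
    unfolding m_sl3_def rep_hom_eq_homogeneous_part
    by (rule n_quot.dim_injective_image_homogeneous_part)
qed

theorem theoremM:
  fixes u :: "complex ^ 2" and k :: nat
  assumes "k \<ge> 1"
  shows "\<exists>v\<^sub>k :: complex. m_sl3 v\<^sub>k u = k"
proof
  show "m_sl3 (u $ 1 + u $ 2 - of_nat (k - 1)) u = k"
    unfolding m_sl3_eq using assms by simp
qed

end
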